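(* Suppose $a:\mathbb{N}\to\mathbb{C}$ is a multiplicative arithmetic function satisfying $$\sum_{p\le x}\frac{|a(p)|^2}{p}=c\log\log x+O(1)$$ for some positive constant $c$. Then, for every real number $r$, $$\prod_{p\le x}\left(1+2^r|a(p)|^2p^{-1}\right)\ll_r\sum_{n\le x}|\mu(n)|\,|a(n)|^2n^{-1}[d(n)]^r .$$
   Context: The letter $p$ denotes a prime, so sums and products over $p\le x$ run over primes. $\mu$ is the Möbius function and $d(n)$ is the number of positive divisors of $n$. Multiplicative means $a(1)=1$ and $a(mn)=a(m)a(n)$ whenever $\gcd(m,n)=1$. The hypothesis is understood for $x\ge 3$ (say), with the $O(1)$ term bounded uniformly in $x$. The notation $f\ll_r g$ means $|f|\le K g$ for a constant $K>0$ that may depend on $r$ and on the function $a$ but not on $x$. *)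

theory Defs
  imports Complex_Main "HOL-Computational_Algebra.Primes" "HOL-Computational_Algebra.Squarefree"
begin

text \<open>Arithmetic functions live on the positive integers; their value at 0 is never used.\<close>

definition multiplicative_fun :: "(nat \<Rightarrow> complex) \<Rightarrow> bool" where
  "multiplicative_fun a \<longleftrightarrow>
     a 1 = 1 \<and> (\<forall>m n. m > 0 \<longrightarrow> n > 0 \<longrightarrow> coprime m n \<longrightarrow> a (m * n) = a m * a n)"

definition moebius :: "nat \<Rightarrow> int" where
  "moebius n = (if squarefree n then (- 1) ^ card (prime_factors n) else 0)"

definition num_divisors :: "nat \<Rightarrow> nat" where
  "num_divisors n = card {d. d dvd n}"

definition primes_le :: "real \<Rightarrow> nat set" where
  "primes_le x = {p. prime p \<and> real p \<le> x}"

definition pos_nats_le :: "real \<Rightarrow> nat set" where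
  "pos_nats_le x = {n. 1 \<le> n \<and> real n \<le> x}"

end

theory Submission
  imports Defs
begin

text \<open>
  Put \<open>w p = 2 powr r * \<bar>a p\<bar>\<^sup>2 / p\<close>. On a squarefree \<open>n\<close>, the product of the primes in a set
  \<open>S\<close>, the summand on the right-hand side equals \<open>\<Prod>p\<in>S. w p\<close>
  (\<open>summand_prod_primes\<close>); on other \<open>n\<close> it vanishes. So the right-hand side
  is the part of the expansion of \<open>\<Prod>p\<le>x. 1 + w p\<close> that belongs to the sets \<open>S\<close> with
  \<open>\<Sum>p\<in>S. ln p \<le> ln x\<close>, and the claim is that this part is not negligible.

  Shrink the product to the primes up to \<open>z = x powr (1 / A)\<close> for a large constant \<open>A\<close>. Choosing
  \<open>S\<close> with probability proportional to \<open>\<Prod>p\<in>S. w p\<close> among the sets of primes up to \<open>z\<close>, the mean of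
  \<open>\<Sum>p\<in>S. ln p\<close> is at most \<open>\<Sum>p\<le>z. w p * ln p\<close>
  (\<open>first_moment_over_subsets_le\<close>), and the hypothesis makes this
  at most \<open>M * ln z\<close> (\<open>sum_weighted_by_ln_le\<close>). Once \<open>A \<ge> 2 * M\<close> this is at most \<open>ln x / 2\<close>,
  so by Markov's inequality at least half of the mass of \<open>\<Prod>p\<le>z. 1 + w p\<close> lies on sets with product
  at most \<open>x\<close> (\<open>prod_one_plus_le_truncated_sum_over_subsets\<close>).

  The removed primes cost only a constant factor: \<open>\<Sum>z<p\<le>x. w p\<close> is, up to a bounded error, a constant
  times \<open>ln (ln x) - ln (ln z) = ln A\<close>. When \<open>z < 3\<close>, the hypothesis says nothing about \<open>z\<close>, but then \<open>x\<close>
  is bounded, and so is the product, while the right-hand side is at least its term \<open>1\<close> at \<open>n = 1\<close>.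
\<close>

section \<open>Markov's inequality for weighted subsets\<close>

lemma sum_over_subsets_insert:
  fixes f :: "'a set \<Rightarrow> real"
  assumes "finite A" "p \<notin> A"
  shows "(\<Sum>S\<in>Pow (insert p A). f S) = (\<Sum>S\<in>Pow A. f S) + (\<Sum>S\<in>Pow A. f (insert p S))"
proof -
  have inj: "inj_on (insert p) (Pow A)"
    using assms(2) by (auto simp: inj_on_def)
  have "(\<Sum>S\<in>Pow (insert p A). f S) = (\<Sum>S\<in>Pow A. f S) + (\<Sum>S\<in>insert p ` Pow A. f S)"
    unfolding Pow_insert using assms by (intro sum.union_disjoint) auto
  with inj show ?thesis
    by (simp add: sum.reindex)
qed

lemma prod_one_plus_eq_sum_over_subsets:
  fixes w :: "'a \<Rightarrow> real"
  assumes "finite A"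
  shows "(\<Prod>p\<in>A. 1 + w p) = (\<Sum>S\<in>Pow A. \<Prod>p\<in>S. w p)"
  using assms
proof (induction A)
  case (insert p A)
  have "(\<Sum>S\<in>Pow A. \<Prod>q\<in>insert p S. w q) = (\<Sum>S\<in>Pow A. w p * (\<Prod>q\<in>S. w q))"
    using insert.hyps by (intro sum.cong refl prod.insert) (auto intro: finite_subset)
  then show ?case
    using insert by (simp add: sum_over_subsets_insert sum_distrib_left [symmetric] algebra_simps)
qed simp

text \<open>
  With \<open>S\<close> drawn with probability proportional to \<open>\<Prod>p\<in>S. w p\<close>, an element \<open>p\<close> belongs to \<open>S\<close> with
  probability \<open>w p / (1 + w p) \<le> w p\<close>; linearity of expectation gives the bound. Phrasing it by
  induction on \<open>A\<close> avoids the division.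
\<close>

lemma first_moment_over_subsets_le:
  fixes w l :: "'a \<Rightarrow> real"
  assumes "finite A" "\<And>p. p \<in> A \<Longrightarrow> w p \<ge> 0" "\<And>p. p \<in> A \<Longrightarrow> l p \<ge> 0"
  shows "(\<Sum>S\<in>Pow A. (\<Sum>p\<in>S. l p) * (\<Prod>p\<in>S. w p))
           \<le> (\<Sum>p\<in>A. w p * l p) * (\<Prod>p\<in>A. 1 + w p)"
  using assms
proof (induction A)
  case (insert p A)
  define Z where "Z = (\<Prod>q\<in>A. 1 + w q)"
  define F where "F = (\<Sum>S\<in>Pow A. (\<Sum>q\<in>S. l q) * (\<Prod>q\<in>S. w q))"
  have IH: "F \<le> (\<Sum>q\<in>A. w q * l q) * Z"
    using insert by (simp add: F_def Z_def)
  have nonneg: "w p \<ge> 0" "l p \<ge> 0" "Z \<ge> 0"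
    using insert.prems unfolding Z_def by (auto intro!: prod_nonneg add_nonneg_nonneg)
  have "(\<Sum>S\<in>Pow A. (\<Sum>q\<in>insert p S. l q) * (\<Prod>q\<in>insert p S. w q))
        = (\<Sum>S\<in>Pow A. w p * ((\<Sum>q\<in>S. l q) * (\<Prod>q\<in>S. w q)) + w p * l p * (\<Prod>q\<in>S. w q))"
  proof (intro sum.cong refl)
    fix S assume "S \<in> Pow A"
    with insert.hyps have "finite S" "p \<notin> S" by (auto intro: finite_subset)
    then show "(\<Sum>q\<in>insert p S. l q) * (\<Prod>q\<in>insert p S. w q)
        = w p * ((\<Sum>q\<in>S. l q) * (\<Prod>q\<in>S. w q)) + w p * l p * (\<Prod>q\<in>S. w q)"
      by (simp add: algebra_simps)
  qed
  also have "\<dots> = w p * F + w p * l p * Z"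
    using insert.hyps
    by (simp add: F_def Z_def prod_one_plus_eq_sum_over_subsets sum.distrib sum_distrib_left)
  finally have "(\<Sum>S\<in>Pow (insert p A). (\<Sum>q\<in>S. l q) * (\<Prod>q\<in>S. w q))
      = (1 + w p) * F + w p * l p * Z"
    using insert.hyps by (simp add: sum_over_subsets_insert F_def algebra_simps)
  also have "\<dots> \<le> (1 + w p) * ((\<Sum>q\<in>A. w q * l q) * Z) + (1 + w p) * (w p * l p * Z)"
    using nonneg IH by (intro add_mono mult_left_mono) (auto simp: algebra_simps)
  finally show ?case
    using insert.hyps by (simp add: Z_def algebra_simps)
qed simp

text \<open>
  The sets with \<open>\<Sum>p\<in>S. l p > L\<close> carry at most half of the mass, because \<open>L\<close> is at least twice the
  upper bound for the mean of \<open>\<Sum>p\<in>S. l p\<close>.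
\<close>

lemma prod_one_plus_le_truncated_sum_over_subsets:
  fixes w l :: "'a \<Rightarrow> real"
  assumes fin: "finite A" and w: "\<And>p. p \<in> A \<Longrightarrow> w p \<ge> 0" and l: "\<And>p. p \<in> A \<Longrightarrow> l p \<ge> 0"
    and L: "L > 0" "2 * (\<Sum>p\<in>A. w p * l p) \<le> L"
  shows "(\<Prod>p\<in>A. 1 + w p) \<le> 2 * (\<Sum>S | S \<subseteq> A \<and> (\<Sum>p\<in>S. l p) \<le> L. \<Prod>p\<in>S. w p)"
proof -
  define Z where "Z = (\<Prod>p\<in>A. 1 + w p)"
  define G where "G = {S. S \<subseteq> A \<and> (\<Sum>p\<in>S. l p) \<le> L}"
  have Z0: "Z \<ge> 0"
    using w unfolding Z_def by (auto intro!: prod_nonneg add_nonneg_nonneg)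
  have w_nonneg: "(\<Prod>p\<in>S. w p) \<ge> 0" and l_nonneg: "(\<Sum>p\<in>S. l p) \<ge> 0" if "S \<in> Pow A" for S
    using that w l by (auto intro!: prod_nonneg sum_nonneg)
  have "L * (\<Sum>S\<in>Pow A - G. \<Prod>p\<in>S. w p) \<le> (\<Sum>S\<in>Pow A - G. (\<Sum>p\<in>S. l p) * (\<Prod>p\<in>S. w p))"
    unfolding sum_distrib_left
    by (intro sum_mono mult_right_mono w_nonneg) (auto simp: G_def)
  also have "\<dots> \<le> (\<Sum>S\<in>Pow A. (\<Sum>p\<in>S. l p) * (\<Prod>p\<in>S. w p))"
    using fin by (intro sum_mono2 mult_nonneg_nonneg w_nonneg l_nonneg) auto
  also have "\<dots> \<le> (\<Sum>p\<in>A. w p * l p) * Z"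
    unfolding Z_def by (rule first_moment_over_subsets_le [OF fin w l])
  also have "\<dots> \<le> L / 2 * Z"
    using L Z0 by (intro mult_right_mono) auto
  finally have "L * (\<Sum>S\<in>Pow A - G. \<Prod>p\<in>S. w p) \<le> L * (Z / 2)" by simp
  then have "(\<Sum>S\<in>Pow A - G. \<Prod>p\<in>S. w p) \<le> Z / 2"
    using L by (simp only: mult_le_cancel_left_pos)
  moreover have "Z = (\<Sum>S\<in>Pow A - G. \<Prod>p\<in>S. w p) + (\<Sum>S\<in>G. \<Prod>p\<in>S. w p)"
    unfolding Z_def prod_one_plus_eq_sum_over_subsets [OF fin]
    using fin by (intro sum.subset_diff) (auto simp: G_def)
  ultimately show ?thesis
    by (simp add: Z_def G_def)
qed

section \<open>A Mertens-type estimate\<close>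

lemma finite_pos_nats_le: "finite (pos_nats_le x)"
proof (rule finite_subset)
  show "pos_nats_le x \<subseteq> {..nat \<lfloor>x\<rfloor>}"
    by (auto simp: pos_nats_le_def le_nat_floor)
qed simp

lemma finite_primes_le: "finite (primes_le x)"
  by (rule finite_subset [OF _ finite_pos_nats_le [of x]])
     (auto simp: primes_le_def pos_nats_le_def dest: prime_gt_0_nat)

text \<open>
  On \<open>sqrt x < p \<le> x\<close> the total weight is at most a constant \<open>D\<close>, since \<open>ln (ln x) - ln (ln (sqrt x)) = ln 2\<close>,
  so that range contributes at most \<open>D * ln x\<close>. Repeated square roots halve the logarithm each
  time, so the contributions form a convergent geometric series.
\<close>

lemma sum_weighted_by_ln_le:
  fixes w :: "nat \<Rightarrow> real"
  assumes w: "\<And>p. w p \<ge> 0"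
    and T: "\<And>x. x \<ge> 3 \<Longrightarrow> \<bar>(\<Sum>p\<in>primes_le x. w p) - C * ln (ln x)\<bar> \<le> B"
  shows "\<exists>M>0. \<forall>x\<ge>3. (\<Sum>p\<in>primes_le x. w p * ln (real p)) \<le> M * ln x"
proof -
  define D where "D = C * ln 2 + 2 * B"
  \<comment> \<open>\<open>M \<ge> 2 * D\<close> closes the recursion \<open>M / 2 + D \<le> M\<close>; the sum up to 9 settles \<open>x \<le> 9\<close>,
     where \<open>sqrt x\<close> may fall below 3.\<close>
  define M where "M = Max {1, 2 * D, (\<Sum>p\<in>primes_le 9. w p * ln (real p))}"
  have M: "M \<ge> 1" "M \<ge> 2 * D" "M \<ge> (\<Sum>p\<in>primes_le 9. w p * ln (real p))"
    by (simp_all add: M_def)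
  have ln_prime: "ln (real p) \<ge> 0" if "p \<in> primes_le x" for p x
    using that prime_gt_0_nat [of p] by (auto simp: primes_le_def)
  have ln3: "ln (3::real) \<ge> 1"
    using exp_le by (simp add: ln_ge_iff)
  have small: "(\<Sum>p\<in>primes_le x. w p * ln (real p)) \<le> M * ln x" if x: "x \<ge> 3" "x \<le> 9" for x
  proof -
    have "(\<Sum>p\<in>primes_le x. w p * ln (real p)) \<le> (\<Sum>p\<in>primes_le 9. w p * ln (real p))"
      using x by (intro sum_mono2 finite_primes_le mult_nonneg_nonneg w ln_prime [of _ 9])
         (auto simp: primes_le_def)
    also have "\<dots> \<le> M * 1" using M by simp
    also have "\<dots> \<le> M * ln x"
    proof (intro mult_left_mono)
      have "ln 3 \<le> ln x" using x by simp
      with ln3 show "1 \<le> ln x" by linarith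
    qed (use M in auto)
    finally show ?thesis .
  qed
  have "(\<Sum>p\<in>primes_le x. w p * ln (real p)) \<le> M * ln x"
    if "x \<ge> 3" "x \<le> 3 ^ (2 ^ n)" for n x
    using that
  proof (induction n arbitrary: x)
    case 0
    then show ?case by (intro small) auto
  next
    case (Suc n)
    show ?case
    proof (cases "x \<le> 9")
      case True
      with Suc.prems show ?thesis by (intro small)
    next
      case False
      define y where "y = sqrt x"
      have y: "y \<ge> 3" "y \<le> 3 ^ (2 ^ n)" "y \<le> x"
      proof -
        show "y \<ge> 3" using False by (simp add: y_def real_le_rsqrt)
        have "y \<le> sqrt ((3 ^ (2 ^ n))\<^sup>2)"
          using Suc.prems unfolding y_def by (simp add: power_mult [symmetric] mult.commute)
        then show "y \<le> 3 ^ (2 ^ n)" by simp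
        show "y \<le> x" using False by (simp add: y_def real_le_lsqrt power2_eq_square)
      qed
      have ln_y: "ln y = ln x / 2"
        using False by (simp add: y_def ln_sqrt)
      have lnx: "ln x > 0" using Suc.prems by simp
      have sub: "primes_le y \<subseteq> primes_le x"
        using y by (auto simp: primes_le_def)
      have "(\<Sum>p\<in>primes_le x - primes_le y. w p * ln (real p))
              \<le> (\<Sum>p\<in>primes_le x - primes_le y. w p * ln x)"
        by (intro sum_mono mult_left_mono w) (auto simp: primes_le_def dest: prime_gt_0_nat)
      also have "\<dots> = ((\<Sum>p\<in>primes_le x. w p) - (\<Sum>p\<in>primes_le y. w p)) * ln x"
        by (simp add: sum_diff [OF finite_primes_le sub] sum_distrib_right [symmetric])
      also have "\<dots> \<le> D * ln x"
      proof (intro mult_right_mono)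
        have "ln (ln x) = ln (ln y) + ln 2"
          using lnx by (simp add: ln_y ln_div)
        then have "C * ln (ln x) = C * ln (ln y) + C * ln 2"
          by (simp add: algebra_simps)
        with T [of x] T [of y] Suc.prems y
        show "(\<Sum>p\<in>primes_le x. w p) - (\<Sum>p\<in>primes_le y. w p) \<le> D"
          unfolding D_def by linarith
      qed (use lnx in simp)
      also have "\<dots> \<le> M / 2 * ln x"
        using M lnx by (intro mult_right_mono) auto
      finally have "(\<Sum>p\<in>primes_le x - primes_le y. w p * ln (real p)) \<le> M / 2 * ln x" .
      moreover have "(\<Sum>p\<in>primes_le y. w p * ln (real p)) \<le> M / 2 * ln x"
        using Suc.IH [OF y(1,2)] by (simp add: ln_y)
      moreover have "(\<Sum>p\<in>primes_le x. w p * ln (real p))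
          = (\<Sum>p\<in>primes_le x - primes_le y. w p * ln (real p)) + (\<Sum>p\<in>primes_le y. w p * ln (real p))"
        by (rule sum.subset_diff [OF sub finite_primes_le])
      ultimately show ?thesis by simp
    qed
  qed
  moreover have "\<exists>n. x \<le> 3 ^ (2 ^ n)" for x :: real
  proof -
    obtain n where "x < 3 ^ n" using real_arch_pow [of 3 x] by auto
    also have "(3::real) ^ n \<le> 3 ^ (2 ^ n)"
      by (intro power_increasing) (simp_all add: less_imp_le)
    finally show ?thesis by (auto intro: less_imp_le)
  qed
  ultimately have "\<forall>x\<ge>3. (\<Sum>p\<in>primes_le x. w p * ln (real p)) \<le> M * ln x" by blast
  with M show ?thesis by (intro exI [of _ M]) auto
qed

section \<open>The summand on squarefree numbers\<close>

text \<open>The divisors of \<open>p * n\<close> split into those of \<open>n\<close> and their multiples by \<open>p\<close>.\<close>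

lemma num_divisors_prime_mult:
  assumes "prime p" "\<not> p dvd n" "n > 0"
  shows "num_divisors (p * n) = 2 * num_divisors n"
proof -
  have p: "p > 0" using assms(1) by (rule prime_gt_0_nat)
  have "{d. d dvd p * n} = {d. d dvd n} \<union> (*) p ` {d. d dvd n}"
  proof (intro equalityI subsetI)
    fix d assume "d \<in> {d. d dvd p * n}"
    then have d: "d dvd p * n" by simp
    show "d \<in> {d. d dvd n} \<union> (*) p ` {d. d dvd n}"
    proof (cases "p dvd d")
      case True
      then obtain e where "d = p * e" by (elim dvdE)
      with d p show ?thesis by auto
    next
      case False
      with assms(1) have "coprime d p"
        by (metis coprime_commute prime_imp_coprime)
      with d show ?thesis by (simp add: coprime_dvd_mult_right_iff)
    qed
  qed auto
  moreover have "{d. d dvd n} \<inter> (*) p ` {d. d dvd n} = {}"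
    using assms(2) by (auto dest: dvd_mult_left)
  moreover have "card ((*) p ` {d. d dvd n}) = card {d. d dvd n}"
    using p by (intro card_image) (auto simp: inj_on_def)
  ultimately show ?thesis
    using assms(3) by (simp add: num_divisors_def card_Un_disjoint)
qed

lemma abs_moebius: "\<bar>moebius n\<bar> = (if squarefree n then 1 else 0)"
  by (simp add: moebius_def power_abs)

lemma prime_not_dvd_prod_primes:
  fixes p :: nat
  assumes "prime p" "finite S" "\<And>q. q \<in> S \<Longrightarrow> prime q" "p \<notin> S"
  shows "\<not> p dvd \<Prod>S"
proof
  assume "p dvd \<Prod>S"
  then obtain q where "q \<in> S" "p dvd q"
    using prime_dvd_prod_iff [OF assms(2,1), of "\<lambda>x. x"] by auto
  with assms primes_dvd_imp_eq [of p q] show False by auto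
qed

definition summand :: "(nat \<Rightarrow> complex) \<Rightarrow> real \<Rightarrow> nat \<Rightarrow> real" where
  "summand a r n =
     real_of_int \<bar>moebius n\<bar> * (cmod (a n))\<^sup>2 / real n * real (num_divisors n) powr r"

lemma summand_nonneg: "summand a r n \<ge> 0"
  by (simp add: summand_def)

lemma summand_1:
  assumes "multiplicative_fun a"
  shows "summand a r 1 = 1"
  using assms by (simp add: summand_def multiplicative_fun_def abs_moebius num_divisors_def)

lemma summand_prod_primes:
  assumes a: "multiplicative_fun a"
    and "finite S" "\<And>p. p \<in> S \<Longrightarrow> prime p"
  shows "summand a r (\<Prod>S) = (\<Prod>p\<in>S. 2 powr r * (cmod (a p))\<^sup>2 / real p)"
  using assms(2,3)
proof (induction S)
  case empty
  show ?case using summand_1 [OF a] by simp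
next
  case (insert p S)
  define n where "n = \<Prod>S"
  have p: "prime p" using insert.prems by simp
  have n: "n > 0"
    unfolding n_def using insert.prems by (intro prod_pos) (auto intro: prime_gt_0_nat)
  have ndvd: "\<not> p dvd n"
    unfolding n_def using insert by (intro prime_not_dvd_prod_primes) auto
  have cop: "coprime p n" using p ndvd by (rule prime_imp_coprime)
  have "a (p * n) = a p * a n"
    using a cop n prime_gt_0_nat [OF p] by (simp add: multiplicative_fun_def)
  moreover have "squarefree (p * n) \<longleftrightarrow> squarefree n"
    using p cop by (auto simp: squarefree_mult_coprime squarefree_prime dest: squarefree_multD)
  ultimately have "summand a r (p * n) = 2 powr r * (cmod (a p))\<^sup>2 / real p * summand a r n"
    using num_divisors_prime_mult [OF p ndvd n]
    by (simp add: summand_def abs_moebius norm_mult power_mult_distrib powr_mult)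
  with insert show ?case by (simp add: n_def)
qed

lemma inj_on_prod_primes: "inj_on \<Prod> {S :: nat set. finite S \<and> (\<forall>p\<in>S. prime p)}"
proof (rule inj_onI)
  fix S T :: "nat set"
  assume S: "S \<in> {S. finite S \<and> (\<forall>p\<in>S. prime p)}" and T: "T \<in> {S. finite S \<and> (\<forall>p\<in>S. prime p)}"
    and eq: "\<Prod>S = \<Prod>T"
  have "U = {p. prime p \<and> p dvd \<Prod>U}" if "finite U" "\<forall>p\<in>U. prime p" for U :: "nat set"
    using that prime_not_dvd_prod_primes [of _ U] by (auto intro: dvd_prodI [of U _ "\<lambda>x. x", simplified])
  from this [of S] this [of T] S T eq show "S = T" by simp
qed

text \<open>
  By unique factorisation, distinct sets \<open>S\<close> yield distinct \<open>n = \<Prod>S\<close>, and \<open>n \<le> x\<close> is the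
  condition on the logarithms; the remaining \<open>n \<le> x\<close> contribute nonnegative terms.
\<close>

lemma truncated_sum_over_prime_sets_le:
  assumes "multiplicative_fun a" "finite A" "\<And>p. p \<in> A \<Longrightarrow> prime p" "x > 0"
  shows "(\<Sum>S | S \<subseteq> A \<and> (\<Sum>p\<in>S. ln (real p)) \<le> ln x. \<Prod>p\<in>S. 2 powr r * (cmod (a p))\<^sup>2 / real p)
           \<le> (\<Sum>n\<in>pos_nats_le x. summand a r n)"
proof -
  define G where "G = {S. S \<subseteq> A \<and> (\<Sum>p\<in>S. ln (real p)) \<le> ln x}"
  have G: "finite S" "\<forall>p\<in>S. prime p" "(\<Sum>p\<in>S. ln (real p)) \<le> ln x" if "S \<in> G" for S
    using that assms(2,3) by (auto simp: G_def intro: finite_subset)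
  have "(\<Sum>S\<in>G. \<Prod>p\<in>S. 2 powr r * (cmod (a p))\<^sup>2 / real p) = (\<Sum>S\<in>G. summand a r (\<Prod>S))"
    using G by (intro sum.cong refl summand_prod_primes [OF assms(1), symmetric]) auto
  also have "\<dots> = (\<Sum>n\<in>\<Prod> ` G. summand a r n)"
    using inj_on_subset [OF inj_on_prod_primes, of G] G by (subst sum.reindex) auto
  also have "\<dots> \<le> (\<Sum>n\<in>pos_nats_le x. summand a r n)"
  proof (intro sum_mono2 finite_pos_nats_le summand_nonneg subsetI)
    fix n assume "n \<in> \<Prod> ` G"
    then obtain S where S: "S \<in> G" "n = \<Prod>S" by auto
    have pos: "n > 0"
      using G [OF S(1)] by (auto simp: S(2) intro!: prod_pos prime_gt_0_nat)
    have "ln (real n) = (\<Sum>p\<in>S. ln (real p))"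
      using G [OF S(1)] unfolding S(2) of_nat_prod
      by (intro ln_prod) (auto dest: prime_gt_0_nat)
    also have "\<dots> \<le> ln x" using G [OF S(1)] by simp
    finally show "n \<in> pos_nats_le x"
      using pos assms(4) by (simp add: pos_nats_le_def)
  qed
  finally show ?thesis by (simp add: G_def)
qed

section \<open>The lower bound\<close>

lemma prod_one_plus_le_exp_sum:
  fixes w :: "'a \<Rightarrow> real"
  assumes "\<And>p. p \<in> A \<Longrightarrow> w p \<ge> 0"
  shows "(\<Prod>p\<in>A. 1 + w p) \<le> exp (\<Sum>p\<in>A. w p)"
proof (cases "finite A")
  case True
  have "(\<Prod>p\<in>A. 1 + w p) \<le> (\<Prod>p\<in>A. exp (w p))"
    using assms by (intro prod_mono) (auto intro: add_nonneg_nonneg)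
  with True show ?thesis by (simp add: exp_sum)
qed simp

theorem theorem3:
  fixes a :: "nat \<Rightarrow> complex" and c :: real
  assumes "multiplicative_fun a"
    and "c > 0"
    and "\<exists>B. \<forall>x\<ge>3. \<bar>(\<Sum>p\<in>primes_le x. (cmod (a p))\<^sup>2 / real p) - c * ln (ln x)\<bar> \<le> B"
  shows "\<forall>r::real. \<exists>K>0. \<forall>x\<ge>3.
           \<bar>\<Prod>p\<in>primes_le x. 1 + 2 powr r * (cmod (a p))\<^sup>2 / real p\<bar>
             \<le> K * (\<Sum>n\<in>pos_nats_le x.
                   real_of_int \<bar>moebius n\<bar> * (cmod (a n))\<^sup>2 / real n * real (num_divisors n) powr r)"
proof
  fix r :: real
  obtain B where B: "\<And>x. x \<ge> 3 \<Longrightarrow>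
      \<bar>(\<Sum>p\<in>primes_le x. (cmod (a p))\<^sup>2 / real p) - c * ln (ln x)\<bar> \<le> B"
    using assms(3) by blast
  define w where "w p = 2 powr r * (cmod (a p))\<^sup>2 / real p" for p
  define C where "C = 2 powr r * c"
  define B' where "B' = 2 powr r * B"
  have w: "w p \<ge> 0" for p by (simp add: w_def)
  have T: "\<bar>(\<Sum>p\<in>primes_le x. w p) - C * ln (ln x)\<bar> \<le> B'" if "x \<ge> 3" for x
  proof -
    have "(\<Sum>p\<in>primes_le x. w p) - C * ln (ln x)
        = 2 powr r * ((\<Sum>p\<in>primes_le x. (cmod (a p))\<^sup>2 / real p) - c * ln (ln x))"
      by (simp add: w_def C_def sum_distrib_left algebra_simps)
    then show ?thesis using B [OF that] by (simp add: abs_mult B'_def)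
  qed
  obtain M where M: "M > 0" "\<And>x. x \<ge> 3 \<Longrightarrow> (\<Sum>p\<in>primes_le x. w p * ln (real p)) \<le> M * ln x"
    using sum_weighted_by_ln_le [OF w T] by blast
  define A where "A = max 1 (2 * M)"
  have A: "A \<ge> 1" "2 * M \<le> A" by (simp_all add: A_def)
  \<comment> \<open>\<open>E\<close> bounds the factor lost with the primes in \<open>(z, x]\<close>; \<open>Q\<close> bounds the whole product when
     \<open>z < 3\<close>, that is, \<open>x < 3 powr A\<close>.\<close>
  define E where "E = exp (C * ln A + 2 * B')"
  define Q where "Q = (\<Prod>p\<in>primes_le (3 powr A). 1 + w p)"
  define K where "K = max (2 * E) Q"
  have K: "K > 0" "2 * E \<le> K" "Q \<le> K"
    by (auto simp: K_def E_def less_max_iff_disj)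
  have prod_nonneg': "(\<Prod>p\<in>P. 1 + w p) \<ge> 0" for P
    using w by (auto intro!: prod_nonneg add_nonneg_nonneg)
  have "\<bar>\<Prod>p\<in>primes_le x. 1 + w p\<bar> \<le> K * (\<Sum>n\<in>pos_nats_le x. summand a r n)"
    if x: "x \<ge> 3" for x
  proof -
    define \<Sigma> where "\<Sigma> = (\<Sum>n\<in>pos_nats_le x. summand a r n)"
    have "summand a r 1 \<le> \<Sigma>"
      unfolding \<Sigma>_def using x
      by (intro member_le_sum summand_nonneg finite_pos_nats_le) (simp add: pos_nats_le_def)
    then have \<Sigma>: "\<Sigma> \<ge> 1" by (simp only: summand_1 [OF assms(1)])
    define z where "z = x powr (1 / A)"
    have ln_z: "ln z = ln x / A" using x by (simp add: z_def ln_powr)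
    have lnx: "ln x > 0" using x by simp
    have "(\<Prod>p\<in>primes_le x. 1 + w p) \<le> K * \<Sigma>"
    proof (cases "z \<ge> 3")
      case True
      have zx: "z \<le> x"
      proof -
        have "ln z \<le> ln x" unfolding ln_z using lnx A by (simp add: divide_le_eq)
        then show ?thesis using True x by simp
      qed
      then have sub: "primes_le z \<subseteq> primes_le x" by (auto simp: primes_le_def)
      have "(\<Prod>p\<in>primes_le z. 1 + w p)
          \<le> 2 * (\<Sum>S | S \<subseteq> primes_le z \<and> (\<Sum>p\<in>S. ln (real p)) \<le> ln x. \<Prod>p\<in>S. w p)"
      proof (intro prod_one_plus_le_truncated_sum_over_subsets finite_primes_le w lnx)
        have "2 * (\<Sum>p\<in>primes_le z. w p * ln (real p)) \<le> 2 * M * ln z"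
          using M(2) [OF True] by simp
        also have "\<dots> \<le> A * ln z" using A True by (intro mult_right_mono) auto
        also have "\<dots> = ln x" using A by (simp add: ln_z)
        finally show "2 * (\<Sum>p\<in>primes_le z. w p * ln (real p)) \<le> ln x" .
      qed (auto simp: primes_le_def dest: prime_gt_0_nat)
      also have "\<dots> \<le> 2 * \<Sigma>"
        unfolding \<Sigma>_def w_def using x
        by (intro mult_left_mono truncated_sum_over_prime_sets_le assms(1) finite_primes_le)
           (auto simp: primes_le_def)
      finally have small: "(\<Prod>p\<in>primes_le z. 1 + w p) \<le> 2 * \<Sigma>" .
      have "(\<Sum>p\<in>primes_le x - primes_le z. w p) \<le> C * ln A + 2 * B'"
      proof -
        have "ln (ln x) = ln (ln z) + ln A"
          using lnx A by (simp add: ln_z ln_div)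
        then have "C * ln (ln x) = C * ln (ln z) + C * ln A"
          by (simp add: algebra_simps)
        with T [OF x] T [OF True] show ?thesis
          unfolding sum_diff [OF finite_primes_le sub] by linarith
      qed
      then have "exp (\<Sum>p\<in>primes_le x - primes_le z. w p) \<le> E"
        by (simp add: E_def)
      with prod_one_plus_le_exp_sum [of "primes_le x - primes_le z" w] w
      have large: "(\<Prod>p\<in>primes_le x - primes_le z. 1 + w p) \<le> E" by fastforce
      have "(\<Prod>p\<in>primes_le x. 1 + w p)
          = (\<Prod>p\<in>primes_le x - primes_le z. 1 + w p) * (\<Prod>p\<in>primes_le z. 1 + w p)"
        by (rule prod.subset_diff [OF sub finite_primes_le])
      also have "\<dots> \<le> E * (2 * \<Sigma>)"
        using small large by (intro mult_mono prod_nonneg') (auto simp: E_def)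
      also have "\<dots> \<le> K * \<Sigma>"
        using K \<Sigma> mult_right_mono [of "2 * E" K \<Sigma>] by (simp add: mult_ac)
      finally show ?thesis .
    next
      case False
      have "x = z powr A" using x A by (simp add: z_def powr_powr)
      also have "\<dots> \<le> 3 powr A" using False A by (intro powr_mono2) (auto simp: z_def)
      finally have "primes_le x \<subseteq> primes_le (3 powr A)" by (auto simp: primes_le_def)
      then have "(\<Prod>p\<in>primes_le x. 1 + w p) \<le> Q"
        unfolding Q_def using w by (intro prod_mono2 finite_primes_le) (auto intro: add_nonneg_nonneg)
      also have "\<dots> \<le> K * \<Sigma>"
        using K mult_left_mono [OF \<Sigma>, of K] by linarith
      finally show ?thesis .
    qed
    then show ?thesis by (simp add: \<Sigma>_def prod_nonneg')
  qed
  with K(1) show "\<exists>K>0. \<forall>x\<ge>3.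
           \<bar>\<Prod>p\<in>primes_le x. 1 + 2 powr r * (cmod (a p))\<^sup>2 / real p\<bar>
             \<le> K * (\<Sum>n\<in>pos_nats_le x.
                   real_of_int \<bar>moebius n\<bar> * (cmod (a n))\<^sup>2 / real n * real (num_divisors n) powr r)"
    unfolding w_def summand_def by blast
qed

end
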